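(* Let $P \in \mathbb{Z}[x]$ be a polynomial of degree $d \geq 2$, and let $(m_n)_{n \geq 1}$ be a sequence of pairwise distinct integers such that, for some $t \in \mathbb{N}$, $|m_n| \leq n^t$ for all $n \geq n(t)$. Then for almost all $\alpha \in \mathbb{R}$ (with respect to Lebesgue measure) the discrepancy $D_N$ of the sequence $(\{P(m_n)\alpha\})_{n \geq 1}$ satisfies the following: for every $\varepsilon > 0$ there are infinitely many $N$ with $$N D_N \geq N^{\frac12 - \varepsilon}.$$
   Context: For real $x$, $\{x\}$ denotes the fractional part of $x$. For a sequence $(x_n)_{n\ge1}$ in $[0,1)$, its discrepancy is $$D_N = \sup_{0 \leq a < b \leq 1} \left| \frac{A_N([a,b))}{N} - (b-a) \right|, \qquad A_N([a,b)) = \#\{1 \leq n \leq N : x_n \in [a,b)\}.$$ *)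

theory Defs
  imports "HOL-Analysis.Analysis" "HOL-Computational_Algebra.Polynomial"
begin

definition count_in :: "(nat \<Rightarrow> real) \<Rightarrow> nat \<Rightarrow> real \<Rightarrow> real \<Rightarrow> nat" where
  "count_in x N a b = card {n \<in> {1..N}. x n \<in> {a..<b}}"

definition discrepancy :: "(nat \<Rightarrow> real) \<Rightarrow> nat \<Rightarrow> real" where
  "discrepancy x N = (SUP (a, b) \<in> {(a, b). 0 \<le> a \<and> a < b \<and> b \<le> 1}.
      \<bar>real (count_in x N a b) / real N - (b - a)\<bar>)"

end

theory Submission
  imports Defs "HOL-Computational_Algebra.Primes"
begin

text \<open>
  By Koksma's inequality, \<open>N D\<^sub>N\<close> is at least a constant times
  \<open>h\<^sup>-\<^sup>1 |\<Sum>\<^bsub>n\<le>N\<^esub> e(h P(m\<^sub>n) \<alpha>)|\<close> for every \<open>h \<ge> 1\<close>. Squaring the sum and adding over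
  \<open>h \<le> H = \<lceil>N\<^sup>\<delta>\<rceil>\<close>, the pairs with \<open>P(m\<^sub>a) = P(m\<^sub>b)\<close> contribute at least \<open>H N\<close>. The second moment
  of the remaining part is the number of solutions of
  \<open>h (P(m\<^sub>a) - P(m\<^sub>b)) = h' (P(m\<^sub>c) - P(m\<^sub>d)) \<noteq> 0\<close>. Given the left-hand side \<open>W\<close>, both \<open>h'\<close> and
  \<open>m\<^sub>c - m\<^sub>d\<close> divide \<open>W\<close>, and they determine \<open>m\<^sub>d\<close> up to \<open>deg P\<close> choices;
  so the divisor bound gives \<open>O(H N\<^bsup>2+\<eta>\<^esup>)\<close> solutions for every \<open>\<eta> > 0\<close>. This is linear in \<open>H\<close>, while
  the squared mean \<open>(H N)\<^sup>2\<close> is quadratic: averaging over the dilations \<open>h\<close> absorbs the loss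
  \<open>N\<^sup>\<eta>\<close>. Chebyshev and Borel--Cantelli along \<open>N = 2\<^sup>k\<close> give, for almost all \<open>\<alpha>\<close> and all large
  \<open>k\<close>, some \<open>h \<le> H\<close> whose exponential sum has modulus at least \<open>\<surd>(N/2)\<close>.
\<close>

section \<open>Koksma's inequality\<close>

lemma count_in_le: "count_in x N a b \<le> N"
proof -
  have "card {n \<in> {1..N}. x n \<in> {a..<b}} \<le> card {1..N}"
    by (intro card_mono) auto
  then show ?thesis by (simp add: count_in_def)
qed

lemma count_in_diff_le_discrepancy:
  assumes "0 \<le> a" "a < b" "b \<le> 1"
  shows "\<bar>real (count_in x N a b) - real N * (b - a)\<bar> \<le> real N * discrepancy x N"
proof (cases "N = 0")
  case True
  then show ?thesis using count_in_le[of x 0 a b] by simp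
next
  case False
  define f where "f = (\<lambda>(a, b). \<bar>real (count_in x N a b) / real N - (b - a)\<bar>)"
  have "bdd_above (f ` {(a, b). 0 \<le> a \<and> a < b \<and> b \<le> 1})"
  proof (rule bdd_aboveI2, clarify)
    fix a b :: real assume "0 \<le> a" "a < b" "b \<le> 1"
    moreover have "0 \<le> real (count_in x N a b) / real N" "real (count_in x N a b) / real N \<le> 1"
      using count_in_le[of x N a b] False by simp_all
    ultimately show "f (a, b) \<le> 1"
      unfolding f_def prod.case abs_le_iff by linarith
  qed
  then have "f (a, b) \<le> discrepancy x N"
    unfolding discrepancy_def f_def[symmetric] using assms by (intro cSUP_upper) auto
  then have "real N * f (a, b) \<le> real N * discrepancy x N"
    by (intro mult_left_mono) auto
  moreover have "real (count_in x N a b) - real N * (b - a)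
      = real N * (real (count_in x N a b) / real N - (b - a))"
    using False by (simp add: field_simps)
  ultimately show ?thesis
    by (simp add: f_def abs_mult)
qed

lemma mult_discrepancy_nonneg: "0 \<le> real N * discrepancy x N"
  using count_in_diff_le_discrepancy[of 0 1 x N] by linarith

lemma count_in_0_diff_le_discrepancy:
  assumes "t \<in> {0..1}"
  shows "\<bar>real (count_in x N 0 t) - real N * t\<bar> \<le> real N * discrepancy x N"
proof (cases "t = 0")
  case True
  then show ?thesis
    using mult_discrepancy_nonneg[of N x] by (simp add: count_in_def)
next
  case False
  then show ?thesis
    using assms count_in_diff_le_discrepancy[of 0 t x N] by simp
qed

lemma has_integral_count_in:
  fixes F F' :: "real \<Rightarrow> 'a::banach"
  assumes unit: "\<And>n. n \<in> {1..N} \<Longrightarrow> x n \<in> {0..<1}"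
    and deriv: "\<And>t. t \<in> {0..1} \<Longrightarrow> (F has_vector_derivative F' t) (at t within {0..1})"
  shows "((\<lambda>t. real (count_in x N 0 t) *\<^sub>R F' t) has_integral (\<Sum>n=1..N. F 1 - F (x n))) {0..1}"
proof -
  have count: "(\<Sum>n=1..N. if x n < t then F' t else 0) = real (count_in x N 0 t) *\<^sub>R F' t" for t
  proof -
    have "{n \<in> {1..N}. x n \<in> {0..<t}} = {1..N} \<inter> {n. x n < t}"
      using unit by force
    then show ?thesis
      by (simp add: sum.If_cases count_in_def scaleR_conv_of_real flip: sum_constant_scaleR)
  qed
  show ?thesis
    unfolding count[symmetric]
  proof (rule has_integral_sum)
    fix n assume "n \<in> {1..N}"
    then have x_n: "0 \<le> x n" "x n < 1" using unit by auto
    then have "(F' has_integral (F 1 - F (x n))) {x n..1}"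
      by (intro fundamental_theorem_of_calculus has_vector_derivative_within_subset[OF deriv]) auto
    then have "((\<lambda>t. if t \<in> {x n..1} then F' t else 0) has_integral (F 1 - F (x n))) {0..1}"
      using x_n by (subst has_integral_restrict) auto
    then show "((\<lambda>t. if x n < t then F' t else 0) has_integral (F 1 - F (x n))) {0..1}"
      by (rule has_integral_spike[rotated 2, where S = "{x n}"]) auto
  qed simp
qed

lemma has_integral_count_in_diff:
  fixes F F' :: "real \<Rightarrow> 'a::banach"
  assumes unit: "\<And>n. n \<in> {1..N} \<Longrightarrow> x n \<in> {0..<1}"
    and deriv: "\<And>t. t \<in> {0..1} \<Longrightarrow> (F has_vector_derivative F' t) (at t within {0..1})"
    and integral: "(F has_integral I) {0..1}"
  shows "((\<lambda>t. (real (count_in x N 0 t) - real N * t) *\<^sub>R F' t) has_integral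
    (real N *\<^sub>R I - (\<Sum>n=1..N. F (x n)))) {0..1}"
proof -
  have "((\<lambda>t. t *\<^sub>R F' t + F t) has_integral (1 *\<^sub>R F 1 - 0 *\<^sub>R F 0)) {0..1}"
    by (rule fundamental_theorem_of_calculus)
      (auto intro!: derivative_eq_intros deriv)
  from has_integral_diff[OF this integral] have "((\<lambda>t. t *\<^sub>R F' t) has_integral (F 1 - I)) {0..1}"
    by simp
  from has_integral_cmul[OF this, of "real N"]
  have "((\<lambda>t. (real N * t) *\<^sub>R F' t) has_integral real N *\<^sub>R (F 1 - I)) {0..1}"
    by simp
  with has_integral_count_in[OF unit deriv]
  have "((\<lambda>t. real (count_in x N 0 t) *\<^sub>R F' t - (real N * t) *\<^sub>R F' t) has_integral
      ((\<Sum>n=1..N. F 1 - F (x n)) - real N *\<^sub>R (F 1 - I))) {0..1}"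
    by (intro has_integral_diff)
  then show ?thesis
    by (simp add: scaleR_left_diff_distrib scaleR_right_diff_distrib sum_subtractf sum_constant_scaleR)
qed

theorem koksma_inequality:
  fixes F F' :: "real \<Rightarrow> 'a::banach"
  assumes unit: "\<And>n. n \<in> {1..N} \<Longrightarrow> x n \<in> {0..<1}"
    and deriv: "\<And>t. t \<in> {0..1} \<Longrightarrow> (F has_vector_derivative F' t) (at t within {0..1})"
    and deriv_le: "\<And>t. t \<in> {0..1} \<Longrightarrow> norm (F' t) \<le> L"
    and integral: "(F has_integral I) {0..1}"
  shows "norm ((\<Sum>n=1..N. F (x n)) - real N *\<^sub>R I) \<le> L * (real N * discrepancy x N)"
proof -
  have "0 \<le> L"
    using deriv_le[of 0] by (auto intro: order_trans[OF norm_ge_zero])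
  have "norm (real N *\<^sub>R I - (\<Sum>n=1..N. F (x n)))
      \<le> (L * (real N * discrepancy x N)) * measure lborel (cbox (0::real) 1)"
  proof (rule has_integral_bound)
    show "0 \<le> L * (real N * discrepancy x N)"
      using \<open>0 \<le> L\<close> mult_discrepancy_nonneg by (rule mult_nonneg_nonneg)
    show "((\<lambda>t. (real (count_in x N 0 t) - real N * t) *\<^sub>R F' t) has_integral
        (real N *\<^sub>R I - (\<Sum>n=1..N. F (x n)))) (cbox 0 1)"
      using has_integral_count_in_diff[OF unit deriv integral] by simp
    fix t :: real assume "t \<in> cbox 0 1"
    then have "t \<in> {0..1}" by simp
    have "norm ((real (count_in x N 0 t) - real N * t) *\<^sub>R F' t)
        = norm (F' t) * \<bar>real (count_in x N 0 t) - real N * t\<bar>"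
      by simp
    also have "\<dots> \<le> L * (real N * discrepancy x N)"
      using \<open>0 \<le> L\<close> \<open>t \<in> {0..1}\<close>
      by (intro mult_mono deriv_le count_in_0_diff_le_discrepancy) auto
    finally show "norm ((real (count_in x N 0 t) - real N * t) *\<^sub>R F' t)
        \<le> L * (real N * discrepancy x N)" .
  qed
  then show ?thesis by (simp add: norm_minus_commute)
qed

section \<open>Mean squares of trigonometric polynomials\<close>

lemma has_vector_derivative_cis_mult:
  "((\<lambda>t. cis (c * t)) has_vector_derivative \<i> * of_real c * cis (c * t)) (at t within S)"
  unfolding cis_conv_exp of_real_mult
  by (rule has_vector_derivative_real_field) (auto intro!: derivative_eq_intros)

lemma cis_2pi_frac: "cis (2 * pi * real_of_int h * frac y) = cis (2 * pi * real_of_int h * y)"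
proof -
  have "2 * pi * real_of_int h * y
      = 2 * pi * real_of_int h * frac y + 2 * pi * real_of_int (h * \<lfloor>y\<rfloor>)"
    by (simp add: frac_def algebra_simps)
  then show ?thesis
    by (simp only: cis_mult[symmetric] cis_multiple_2pi Ints_of_int mult_1_right)
qed

lemma has_integral_cis_2pi:
  fixes k :: int and j :: real
  shows "((\<lambda>t. cis (2 * pi * real_of_int k * t)) has_integral (if k = 0 then 1 else 0)) {j..j+1}"
proof (cases "k = 0")
  case True
  then show ?thesis
    using has_integral_const_real[of "1 :: complex" j "j + 1"] by simp
next
  case False
  define c where "c = 2 * pi * real_of_int k"
  have "c \<noteq> 0" using False by (simp add: c_def)
  have "cis (c * (j + 1)) = cis (c * j) * cis (2 * pi * real_of_int k)"
    by (simp add: cis_mult c_def algebra_simps del: cis_multiple_2pi)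
  then have period: "cis (c * (j + 1)) = cis (c * j)" by simp
  have "((\<lambda>t. cis (c * t)) has_integral
      (cis (c * (j + 1)) / (\<i> * of_real c) - cis (c * j) / (\<i> * of_real c))) {j..j+1}"
  proof (rule fundamental_theorem_of_calculus)
    fix t :: real
    show "((\<lambda>t. cis (c * t) / (\<i> * of_real c)) has_vector_derivative cis (c * t)) (at t within {j..j+1})"
      using has_vector_derivative_divide[OF has_vector_derivative_cis_mult[of c t], of "\<i> * of_real c"]
        \<open>c \<noteq> 0\<close> by simp
  qed simp
  then show ?thesis
    unfolding period diff_self using False by (simp add: c_def)
qed

definition trig_poly :: "('i \<Rightarrow> int) \<Rightarrow> 'i set \<Rightarrow> real \<Rightarrow> complex" where
  "trig_poly w I t = (\<Sum>i\<in>I. cis (2 * pi * real_of_int (w i) * t))"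

lemma continuous_on_trig_poly [continuous_intros]:
  "continuous_on S f \<Longrightarrow> continuous_on S (\<lambda>t. trig_poly w I (f t))"
  unfolding trig_poly_def by (intro continuous_intros)

definition weyl_sum :: "(nat \<Rightarrow> int) \<Rightarrow> int \<Rightarrow> nat \<Rightarrow> real \<Rightarrow> complex" where
  "weyl_sum q h N = trig_poly (\<lambda>n. h * q n) {1..N}"

lemma norm_weyl_sum_le_discrepancy:
  assumes "h \<noteq> 0"
  shows "norm (weyl_sum q h N \<alpha>)
    \<le> 2 * pi * \<bar>real_of_int h\<bar> * (real N * discrepancy (\<lambda>n. frac (real_of_int (q n) * \<alpha>)) N)"
proof -
  let ?c = "2 * pi * real_of_int h" and ?x = "\<lambda>n. frac (real_of_int (q n) * \<alpha>)"
  have "norm ((\<Sum>n=1..N. cis (?c * ?x n)) - real N *\<^sub>R 0)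
      \<le> 2 * pi * \<bar>real_of_int h\<bar> * (real N * discrepancy ?x N)"
  proof (rule koksma_inequality)
    show "?x n \<in> {0..<1}" for n
      by (simp add: frac_lt_1)
    show "((\<lambda>t. cis (?c * t)) has_vector_derivative \<i> * of_real ?c * cis (?c * t)) (at t within {0..1})" for t
      by (rule has_vector_derivative_cis_mult)
    show "norm (\<i> * of_real ?c * cis (?c * t)) \<le> 2 * pi * \<bar>real_of_int h\<bar>" for t
      by (simp add: norm_mult abs_mult)
    show "((\<lambda>t. cis (?c * t)) has_integral 0) {0..1}"
      using has_integral_cis_2pi[of h 0] assms by simp
  qed
  moreover have "(\<Sum>n=1..N. cis (?c * ?x n)) = weyl_sum q h N \<alpha>"
    by (simp only: weyl_sum_def trig_poly_def cis_2pi_frac) (simp add: mult.assoc)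
  ultimately show ?thesis by simp
qed

lemma norm_trig_poly_square:
  "complex_of_real ((norm (trig_poly w I t))\<^sup>2) = trig_poly (\<lambda>(i, i'). w i - w i') (I \<times> I) t"
proof -
  have "complex_of_real ((norm (trig_poly w I t))\<^sup>2)
      = (\<Sum>i\<in>I. \<Sum>i'\<in>I. cis (2 * pi * real_of_int (w i) * t) * cis (- (2 * pi * real_of_int (w i') * t)))"
    by (simp add: complex_norm_square trig_poly_def sum_product cis_cnj del: of_real_power)
  also have "\<dots> = trig_poly (\<lambda>(i, i'). w i - w i') (I \<times> I) t"
    by (simp add: trig_poly_def sum.cartesian_product cis_mult split_def algebra_simps)
  finally show ?thesis .
qed

definition collisions :: "('i \<Rightarrow> 'b) \<Rightarrow> 'i set \<Rightarrow> ('i \<times> 'i) set" where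
  "collisions w I = (SIGMA i:I. {i' \<in> I. w i' = w i})"

lemma card_collisions_le:
  fixes C :: real
  assumes "finite I" "\<And>i. i \<in> I \<Longrightarrow> real (card {i' \<in> I. w i' = w i}) \<le> C"
  shows "real (card (collisions w I)) \<le> C * real (card I)"
proof -
  have "real (card (collisions w I)) = (\<Sum>i\<in>I. real (card {i' \<in> I. w i' = w i}))"
    using \<open>finite I\<close> by (simp add: collisions_def)
  also have "\<dots> \<le> (\<Sum>i\<in>I. C)"
    by (intro sum_mono assms)
  finally show ?thesis by (simp add: mult.commute)
qed

lemma has_integral_norm_trig_poly_square:
  assumes "finite I"
  shows "((\<lambda>t. (norm (trig_poly w I t))\<^sup>2) has_integral real (card (collisions w I))) {j..j+1}"
proof -
  have "collisions w I = (I \<times> I) \<inter> {z. case z of (i, i') \<Rightarrow> w i - w i' = 0}"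
    by (auto simp: collisions_def)
  then have count: "(\<Sum>z\<in>I \<times> I. if (case z of (i, i') \<Rightarrow> w i - w i') = 0 then 1 else 0)
      = complex_of_nat (card (collisions w I))"
    using assms by (simp add: sum.If_cases split_def)
  have "(trig_poly (\<lambda>(i, i'). w i - w i') (I \<times> I) has_integral
      (\<Sum>z\<in>I \<times> I. if (case z of (i, i') \<Rightarrow> w i - w i') = 0 then 1 else 0)) {j..j+1}"
    unfolding trig_poly_def using assms by (intro has_integral_sum has_integral_cis_2pi) auto
  then have "((\<lambda>t. complex_of_real ((norm (trig_poly w I t))\<^sup>2)) has_integral
      of_nat (card (collisions w I))) {j..j+1}"
    unfolding norm_trig_poly_square count .
  from has_integral_Re[OF this] show ?thesis by simp
qed

lemma
  fixes w :: "'i \<Rightarrow> int" and c j :: real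
  assumes "finite I" "c > 0"
  defines "A \<equiv> {t \<in> {j..j+1}. c \<le> norm (trig_poly w I t)}"
  shows trig_poly_large_set_measurable: "A \<in> sets lborel"
    and emeasure_trig_poly_large_set_finite: "emeasure lborel A < \<infinity>"
    and measure_trig_poly_large_set_le: "measure lborel A \<le> real (card (collisions w I)) / c\<^sup>2"
proof -
  let ?T = "\<lambda>t. (norm (trig_poly w I t))\<^sup>2"
  let ?u = "\<lambda>t. indicator {j..j+1} t *\<^sub>R ?T t"
  show measurable: "A \<in> sets lborel"
  proof -
    have "closed A"
      unfolding A_def by (intro continuous_on_closed_Collect_le continuous_intros)
    then show ?thesis by simp
  qed
  have "emeasure lborel A \<le> emeasure lborel {j..j+1}"
    by (intro emeasure_mono) (auto simp: A_def)
  then show "emeasure lborel A < \<infinity>"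
    by (auto intro: order_le_less_trans)
  have integrable: "set_integrable lborel {j..j+1} ?T"
    by (intro borel_integrable_atLeastAtMost' continuous_intros)
  have "A = {t \<in> space lborel. ?u t \<ge> c\<^sup>2}"
    using \<open>c > 0\<close> by (auto simp: A_def indicator_def power_mono intro: power2_le_imp_le split: if_splits)
  also have "measure lborel \<dots> \<le> (\<integral>t. ?u t \<partial>lborel) / c\<^sup>2"
    using integrable \<open>c > 0\<close> measurable
    by (intro integral_Markov_inequality_measure[of _ _ A]) (auto simp: set_integrable_def)
  also have "(\<integral>t. ?u t \<partial>lborel) = integral {j..j+1} ?T"
    using set_borel_integral_eq_integral(2)[OF integrable] by (simp add: set_lebesgue_integral_def)
  also have "\<dots> = real (card (collisions w I))"
    using has_integral_norm_trig_poly_square[OF \<open>finite I\<close>] by (rule integral_unique)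
  finally show "measure lborel A \<le> real (card (collisions w I)) / c\<^sup>2" .
qed

section \<open>Discrepancy and collisions of dilated differences\<close>

definition dilated_diff :: "(nat \<Rightarrow> int) \<Rightarrow> nat \<times> nat \<times> nat \<Rightarrow> int" where
  "dilated_diff q = (\<lambda>(h, a, b). int h * (q a - q b))"

definition nonzero_triples :: "(nat \<Rightarrow> int) \<Rightarrow> nat \<Rightarrow> nat \<Rightarrow> (nat \<times> nat \<times> nat) set" where
  "nonzero_triples q H N = {i \<in> {1..H} \<times> {1..N} \<times> {1..N}. dilated_diff q i \<noteq> 0}"

definition nonzero_frequency_sum :: "(nat \<Rightarrow> int) \<Rightarrow> nat \<Rightarrow> nat \<Rightarrow> real \<Rightarrow> complex" where
  "nonzero_frequency_sum q H N = trig_poly (dilated_diff q) (nonzero_triples q H N)"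

definition dilate_collisions ::
    "(nat \<Rightarrow> int) \<Rightarrow> nat \<Rightarrow> nat \<Rightarrow> ((nat \<times> nat \<times> nat) \<times> (nat \<times> nat \<times> nat)) set" where
  "dilate_collisions q H N = collisions (dilated_diff q) (nonzero_triples q H N)"

text \<open>There are at most \<open>H N\<^sup>2\<close> triples, so the bound allows \<open>O(N\<^sup>\<delta>)\<close> collisions per triple.\<close>

definition few_dilate_collisions :: "(nat \<Rightarrow> int) \<Rightarrow> bool" where
  "few_dilate_collisions q \<longleftrightarrow> (\<forall>\<delta>>0. \<exists>M. \<forall>N\<ge>1. \<forall>H\<le>N.
    real (card (dilate_collisions q H N)) \<le> M * real N powr \<delta> * real (H * N\<^sup>2))"

definition max_dilation :: "real \<Rightarrow> nat \<Rightarrow> nat" where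
  "max_dilation \<delta> N = nat \<lceil>real N powr \<delta>\<rceil>"

lemma finite_nonzero_triples: "finite (nonzero_triples q H N)"
  by (simp add: nonzero_triples_def)

lemma card_nonzero_triples_le: "card (nonzero_triples q H N) \<le> H * N\<^sup>2"
proof -
  have "card (nonzero_triples q H N) \<le> card ({1..H} \<times> {1..N} \<times> {1..N})"
    unfolding nonzero_triples_def by (intro card_mono) auto
  then show ?thesis
    by (simp add: card_cartesian_product power2_eq_square)
qed

lemma card_dilate_collisions_le:
  fixes C :: real
  assumes "0 \<le> C" "\<And>i. i \<in> nonzero_triples q H N \<Longrightarrow>
    real (card {i' \<in> nonzero_triples q H N. dilated_diff q i' = dilated_diff q i}) \<le> C"
  shows "real (card (dilate_collisions q H N)) \<le> C * real (H * N\<^sup>2)"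
proof -
  have "real (card (dilate_collisions q H N)) \<le> C * real (card (nonzero_triples q H N))"
    unfolding dilate_collisions_def using finite_nonzero_triples assms(2) by (rule card_collisions_le)
  also have "\<dots> \<le> C * real (H * N\<^sup>2)"
    using \<open>0 \<le> C\<close> by (intro mult_left_mono of_nat_mono card_nonzero_triples_le)
  finally show ?thesis .
qed

lemma max_dilation_ge: "real N powr \<delta> \<le> real (max_dilation \<delta> N)"
  unfolding max_dilation_def by linarith

lemma max_dilation_le:
  assumes "N \<ge> 1" "0 \<le> \<delta>"
  shows "real (max_dilation \<delta> N) \<le> 2 * real N powr \<delta>"
proof -
  have "1 \<le> real N powr \<delta>"
    using assms by (intro ge_one_powr_ge_zero) auto
  then show ?thesis
    unfolding max_dilation_def by linarith
qed

lemma max_dilation_le_self: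
  assumes "N \<ge> 1" "\<delta> \<le> 1"
  shows "max_dilation \<delta> N \<le> N"
proof -
  have "real N powr \<delta> \<le> real N powr 1"
    using assms by (intro powr_mono) auto
  then show ?thesis
    by (simp add: max_dilation_def nat_le_iff ceiling_le_iff)
qed

lemma max_dilation_pos: "N \<ge> 1 \<Longrightarrow> 0 < max_dilation \<delta> N"
  by (simp add: max_dilation_def)

lemma sum_norm_weyl_sum_square:
  "complex_of_real (\<Sum>h=1..H. (norm (weyl_sum q (int h) N \<alpha>))\<^sup>2)
    = trig_poly (dilated_diff q) ({1..H} \<times> {1..N} \<times> {1..N}) \<alpha>"
  unfolding of_real_sum weyl_sum_def norm_trig_poly_square
  by (simp add: trig_poly_def dilated_diff_def sum.cartesian_product split_def right_diff_distrib)

lemma sum_norm_weyl_sum_square_ge: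
  "real (H * N) - norm (nonzero_frequency_sum q H N \<alpha>)
    \<le> (\<Sum>h=1..H. (norm (weyl_sum q (int h) N \<alpha>))\<^sup>2)"
proof -
  define B where "B = {1..H} \<times> {1..N} \<times> {1..N}"
  define I where "I = nonzero_triples q H N"
  have diagonal: "(\<lambda>(h, a). (h, a, a)) ` ({1..H} \<times> {1..N}) \<subseteq> B - I"
    by (auto simp: B_def I_def nonzero_triples_def dilated_diff_def)
  have "H * N = card ((\<lambda>(h, a). (h, a, a)) ` ({1..H} \<times> {1..N}))"
    by (subst card_image) (auto simp: inj_on_def card_cartesian_product)
  also have "\<dots> \<le> card (B - I)"
    by (rule card_mono[OF _ diagonal]) (simp add: B_def)
  finally have "real (H * N) \<le> real (card (B - I))"
    by (rule of_nat_mono)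
  moreover have "complex_of_real (\<Sum>h=1..H. (norm (weyl_sum q (int h) N \<alpha>))\<^sup>2)
      = of_nat (card (B - I)) + trig_poly (dilated_diff q) I \<alpha>"
  proof -
    have "trig_poly (dilated_diff q) B \<alpha>
        = trig_poly (dilated_diff q) (B - I) \<alpha> + trig_poly (dilated_diff q) I \<alpha>"
      unfolding trig_poly_def by (rule sum.subset_diff) (auto simp: B_def I_def nonzero_triples_def)
    moreover have "trig_poly (dilated_diff q) (B - I) \<alpha> = of_nat (card (B - I))"
      by (simp add: trig_poly_def B_def I_def nonzero_triples_def)
    ultimately show ?thesis
      by (simp only: sum_norm_weyl_sum_square B_def)
  qed
  from arg_cong[OF this, of Re]
  have "(\<Sum>h=1..H. (norm (weyl_sum q (int h) N \<alpha>))\<^sup>2)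
      = real (card (B - I)) + Re (trig_poly (dilated_diff q) I \<alpha>)"
    by (simp del: of_real_sum of_real_power)
  moreover have "- norm (trig_poly (dilated_diff q) I \<alpha>) \<le> Re (trig_poly (dilated_diff q) I \<alpha>)"
    using abs_Re_le_cmod[of "trig_poly (dilated_diff q) I \<alpha>"] by linarith
  ultimately show ?thesis
    unfolding I_def nonzero_frequency_sum_def by linarith
qed

lemma ex_large_dilate:
  assumes "norm (nonzero_frequency_sum q H N \<alpha>) < real (H * N) / 2"
  obtains h where "h \<in> {1..H}" "real N / 2 \<le> (norm (weyl_sum q (int h) N \<alpha>))\<^sup>2"
proof (rule ccontr)
  assume "\<not> thesis"
  with that have "(\<Sum>h=1..H. (norm (weyl_sum q (int h) N \<alpha>))\<^sup>2) \<le> (\<Sum>h=1..H. real N / 2)"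
    by (intro sum_mono) force
  also have "\<dots> = real (H * N) / 2" by simp
  finally show False
    using sum_norm_weyl_sum_square_ge[of H N q \<alpha>] assms by linarith
qed

lemma discrepancy_ge_powr:
  fixes \<delta> \<alpha> :: real
  assumes "N \<ge> 1" "0 \<le> \<delta>"
    and N_large: "8 * pi \<le> real N powr \<delta>"
    and small: "norm (nonzero_frequency_sum q (max_dilation \<delta> N) N \<alpha>)
      < real (max_dilation \<delta> N * N) / 2"
  shows "real N powr (1/2 - 2 * \<delta>) \<le> real N * discrepancy (\<lambda>n. frac (real_of_int (q n) * \<alpha>)) N"
proof -
  define D where "D = real N * discrepancy (\<lambda>n. frac (real_of_int (q n) * \<alpha>)) N"
  have "D \<ge> 0" unfolding D_def by (rule mult_discrepancy_nonneg)
  obtain h where "h \<in> {1..max_dilation \<delta> N}"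
    and weyl_sum_large: "real N / 2 \<le> (norm (weyl_sum q (int h) N \<alpha>))\<^sup>2"
    using ex_large_dilate[OF small] .
  then have "real h \<le> 2 * real N powr \<delta>"
    using max_dilation_le[OF assms(1,2)] by simp
  have "real N powr (1/2 - 2 * \<delta>) * (real N powr \<delta> * real N powr \<delta>) = sqrt (real N)"
    using \<open>N \<ge> 1\<close> by (simp add: powr_half_sqrt flip: powr_add)
  also have "\<dots> \<le> 2 * norm (weyl_sum q (int h) N \<alpha>)"
    using weyl_sum_large by (intro real_le_lsqrt) (auto simp: power_mult_distrib)
  also have "\<dots> \<le> 2 * (2 * pi * real h * D)"
    using norm_weyl_sum_le_discrepancy[of "int h" q N \<alpha>] \<open>h \<in> _\<close> by (simp add: D_def mult_ac)
  also have "\<dots> \<le> 2 * (2 * pi * (2 * real N powr \<delta>) * D)"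
    using \<open>real h \<le> _\<close> \<open>D \<ge> 0\<close> by (intro mult_left_mono mult_right_mono) auto
  also have "\<dots> = (8 * pi) * (real N powr \<delta> * D)" by simp
  also have "\<dots> \<le> real N powr \<delta> * (real N powr \<delta> * D)"
    using N_large \<open>D \<ge> 0\<close> by (intro mult_right_mono) auto
  also have "\<dots> = D * (real N powr \<delta> * real N powr \<delta>)" by simp
  finally show ?thesis
    using \<open>N \<ge> 1\<close> by (subst (asm) mult_le_cancel_right_pos) (auto simp: D_def)
qed

lemma measure_nonzero_frequency_sum_large_le:
  fixes \<delta> j M :: real
  assumes "N \<ge> 1"
  defines "H \<equiv> max_dilation \<delta> N"
  assumes collisions: "real (card (dilate_collisions q H N))
      \<le> M * real N powr (\<delta> / 2) * real (H * N\<^sup>2)"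
  shows "measure lborel {\<alpha> \<in> {j..j+1}.
      real (H * N) / 2 \<le> norm (nonzero_frequency_sum q H N \<alpha>)}
    \<le> 4 * M * real N powr (- \<delta> / 2)"
proof -
  have "real N powr \<delta> \<le> real H" "H > 0"
    unfolding H_def using \<open>N \<ge> 1\<close> by (simp_all add: max_dilation_ge max_dilation_pos)
  have "M \<ge> 0"
  proof (rule ccontr)
    assume "\<not> M \<ge> 0"
    then have "M * (real N powr (\<delta> / 2) * real (H * N\<^sup>2)) < 0"
      using \<open>H > 0\<close> \<open>N \<ge> 1\<close> by (intro mult_neg_pos) auto
    then show False
      using collisions by (simp add: mult.assoc)
  qed
  have "measure lborel {\<alpha> \<in> {j..j+1}.
      real (H * N) / 2 \<le> norm (nonzero_frequency_sum q H N \<alpha>)}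
      \<le> real (card (dilate_collisions q H N)) / (real (H * N) / 2)\<^sup>2"
    unfolding nonzero_frequency_sum_def dilate_collisions_def using \<open>H > 0\<close> \<open>N \<ge> 1\<close>
    by (intro measure_trig_poly_large_set_le finite_nonzero_triples) simp
  also have "\<dots> \<le> (M * real N powr (\<delta> / 2) * real (H * N\<^sup>2)) / (real (H * N) / 2)\<^sup>2"
    using collisions by (rule divide_right_mono) simp
  also have "\<dots> = 4 * M * (real N powr (\<delta> / 2) / real H)"
    using \<open>H > 0\<close> \<open>N \<ge> 1\<close> by (simp add: field_simps power2_eq_square)
  also have "\<dots> \<le> 4 * M * (real N powr (\<delta> / 2) / real N powr \<delta>)"
    using \<open>M \<ge> 0\<close> \<open>real N powr \<delta> \<le> real H\<close> \<open>H > 0\<close> \<open>N \<ge> 1\<close>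
    by (intro mult_left_mono divide_left_mono mult_pos_pos) auto
  also have "real N powr (\<delta> / 2) / real N powr \<delta> = real N powr (- \<delta> / 2)"
    by (simp flip: powr_diff)
  finally show ?thesis .
qed

lemma power2_powr: "real (2 ^ k) powr s = (2 powr s) ^ k"
  by (simp add: powr_powr mult.commute flip: powr_realpow)

lemma summable_power2_powr:
  fixes s :: real
  assumes "s < 0"
  shows "summable (\<lambda>k. real (2 ^ k) powr s)"
  unfolding power2_powr using assms by (simp add: powr_less_one summable_geometric)

lemma AE_lborel_unit_intervals:
  assumes "\<And>j::int. AE x in lborel. x \<in> {real_of_int j..real_of_int j + 1} \<longrightarrow> P x"
  shows "AE x in lborel. P x"
proof -
  have "AE x in lborel. \<forall>j::int. x \<in> {real_of_int j..real_of_int j + 1} \<longrightarrow> P x"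
    unfolding AE_all_countable using assms by blast
  then show ?thesis
  proof eventually_elim
    case (elim x)
    have "x \<in> {real_of_int \<lfloor>x\<rfloor>..real_of_int \<lfloor>x\<rfloor> + 1}"
      by (auto intro: less_imp_le)
    then show ?case using elim by blast
  qed
qed

lemma AE_eventually_nonzero_frequency_sum_small:
  fixes \<delta> :: real
  assumes "few_dilate_collisions q" "0 < \<delta>" "\<delta> \<le> 1"
  shows "AE \<alpha> in lborel. \<forall>\<^sub>F k in sequentially.
    norm (nonzero_frequency_sum q (max_dilation \<delta> (2 ^ k)) (2 ^ k) \<alpha>)
      < real (max_dilation \<delta> (2 ^ k) * 2 ^ k) / 2"
proof (rule AE_lborel_unit_intervals)
  fix j :: int
  define H where "H k = max_dilation \<delta> (2 ^ k)" for k
  define A where "A k = {\<alpha> \<in> {real_of_int j..real_of_int j + 1}.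
    real (H k * 2 ^ k) / 2 \<le> norm (nonzero_frequency_sum q (H k) (2 ^ k) \<alpha>)}" for k
  have H_bounds: "0 < H k" "H k \<le> 2 ^ k" for k
    unfolding H_def using \<open>\<delta> \<le> 1\<close> by (simp_all add: max_dilation_pos max_dilation_le_self)
  obtain M where collisions_le: "real (card (dilate_collisions q H N))
      \<le> M * real N powr (\<delta> / 2) * real (H * N\<^sup>2)" if "N \<ge> 1" "H \<le> N" for H N
    using assms(1) half_gt_zero[OF \<open>0 < \<delta>\<close>] unfolding few_dilate_collisions_def by metis
  have measure_le: "measure lborel (A k) \<le> 4 * M * real (2 ^ k) powr (- \<delta> / 2)" for k
    using measure_nonzero_frequency_sum_large_le[of "2 ^ k" q \<delta> M "real_of_int j"]
      collisions_le[of "2 ^ k" "H k"] H_bounds(2)[of k] by (simp add: A_def H_def)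
  have "summable (\<lambda>k. 4 * M * real (2 ^ k) powr (- \<delta> / 2))"
    using \<open>0 < \<delta>\<close> by (intro summable_mult summable_power2_powr) simp
  then have "summable (\<lambda>k. measure lborel (A k))"
    by (rule summable_comparison_test'[where N = 0]) (use measure_le in simp)
  moreover have "A k \<in> sets lborel" for k
    unfolding A_def nonzero_frequency_sum_def using H_bounds(1)[of k]
    by (intro trig_poly_large_set_measurable finite_nonzero_triples) simp
  moreover have "emeasure lborel (A k) < \<infinity>" for k
    unfolding A_def nonzero_frequency_sum_def using H_bounds(1)[of k]
    by (intro emeasure_trig_poly_large_set_finite finite_nonzero_triples) simp
  ultimately have "AE \<alpha> in lborel. \<forall>\<^sub>F k in sequentially. \<alpha> \<in> space lborel - A k"
    by (intro borel_cantelli_AE1)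
  then show "AE \<alpha> in lborel. \<alpha> \<in> {real_of_int j..real_of_int j + 1} \<longrightarrow>
      (\<forall>\<^sub>F k in sequentially.
        norm (nonzero_frequency_sum q (max_dilation \<delta> (2 ^ k)) (2 ^ k) \<alpha>)
          < real (max_dilation \<delta> (2 ^ k) * 2 ^ k) / 2)"
    unfolding H_def[symmetric]
    by eventually_elim (auto simp: A_def not_le elim: eventually_mono)
qed

lemma AE_eventually_discrepancy_ge_powr:
  fixes \<delta> :: real
  assumes "few_dilate_collisions q" "0 < \<delta>" "\<delta> \<le> 1"
  shows "AE \<alpha> in lborel. \<forall>\<^sub>F k in sequentially. real (2 ^ k) powr (1/2 - 2 * \<delta>)
    \<le> real (2 ^ k) * discrepancy (\<lambda>n. frac (real_of_int (q n) * \<alpha>)) (2 ^ k)"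
proof -
  have "filterlim (\<lambda>k. (2 powr \<delta>) ^ k) at_top sequentially"
    using \<open>0 < \<delta>\<close>
    by (intro filterlim_at_infinity_imp_filterlim_at_top filterlim_realpow_sequentially_gt1) auto
  then have large: "\<forall>\<^sub>F k in sequentially. 8 * pi \<le> real (2 ^ k) powr \<delta>"
    unfolding power2_powr by (simp add: filterlim_at_top)
  show ?thesis
    using AE_eventually_nonzero_frequency_sum_small[OF assms]
  proof eventually_elim
    case (elim \<alpha>)
    then show ?case
      using large
      by eventually_elim (use assms in \<open>intro discrepancy_ge_powr, auto\<close>)
  qed
qed

lemma frequently_sequentially_subseq:
  fixes r :: "nat \<Rightarrow> nat"
  assumes "strict_mono r" "\<forall>\<^sub>F k in sequentially. P (r k)"
  shows "\<exists>\<^sub>\<infinity>n. P n"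
  unfolding cofinite_eq_sequentially
proof (rule ccontr)
  assume "\<not> (\<exists>\<^sub>F n in sequentially. P n)"
  then have "\<forall>\<^sub>F k in sequentially. \<not> P (r k)"
    unfolding not_frequently
    by (rule eventually_compose_filterlim) (rule filterlim_subseq[OF assms(1)])
  with assms(2) have "\<forall>\<^sub>F k in sequentially. False"
    by eventually_elim simp
  then show False by simp
qed

lemma AE_INFM_powr_leI:
  fixes D :: "'a \<Rightarrow> nat \<Rightarrow> real"
  assumes "\<And>\<epsilon>. 0 < \<epsilon> \<Longrightarrow> AE x in M. \<exists>\<^sub>\<infinity>N. real N powr (c - \<epsilon>) \<le> D x N"
  shows "AE x in M. \<forall>\<epsilon>>0. \<exists>\<^sub>\<infinity>N. real N powr (c - \<epsilon>) \<le> D x N"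
proof -
  have "AE x in M. \<forall>i. \<exists>\<^sub>\<infinity>N. real N powr (c - inverse (real (Suc i))) \<le> D x N"
    unfolding AE_all_countable using assms by simp
  then show ?thesis
  proof (eventually_elim, intro allI impI)
    fix x and \<epsilon> :: real
    assume frequently: "\<forall>i. \<exists>\<^sub>\<infinity>N. real N powr (c - inverse (real (Suc i))) \<le> D x N" and "0 < \<epsilon>"
    obtain i where i_less: "inverse (real (Suc i)) < \<epsilon>"
      using reals_Archimedean[OF \<open>0 < \<epsilon>\<close>] by blast
    have "real N powr (c - \<epsilon>) \<le> real N powr (c - inverse (real (Suc i)))" for N
      using i_less by (cases "N = 0") (auto intro!: powr_mono)
    with frequently[rule_format, of i] show "\<exists>\<^sub>\<infinity>N. real N powr (c - \<epsilon>) \<le> D x N"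
      by (auto elim!: frequently_elim1 intro: order_trans)
  qed
qed

theorem AE_infinitely_often_discrepancy_ge_powr:
  assumes "few_dilate_collisions q"
  shows "AE \<alpha> in lborel. \<forall>\<epsilon>>0. \<exists>\<^sub>\<infinity>N. real N powr (1/2 - \<epsilon>)
    \<le> real N * discrepancy (\<lambda>n. frac (real_of_int (q n) * \<alpha>)) N"
proof (rule AE_INFM_powr_leI)
  fix \<epsilon> :: real assume "0 < \<epsilon>"
  define \<delta> where "\<delta> = min (\<epsilon> / 2) 1"
  have \<delta>_bounds: "0 < \<delta>" "\<delta> \<le> 1" "2 * \<delta> \<le> \<epsilon>"
    using \<open>0 < \<epsilon>\<close> by (auto simp: \<delta>_def)
  show "AE \<alpha> in lborel. \<exists>\<^sub>\<infinity>N. real N powr (1/2 - \<epsilon>)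
      \<le> real N * discrepancy (\<lambda>n. frac (real_of_int (q n) * \<alpha>)) N"
    using AE_eventually_discrepancy_ge_powr[OF assms \<delta>_bounds(1,2)]
  proof eventually_elim
    case (elim \<alpha>)
    have "real (2 ^ k) powr (1/2 - \<epsilon>) \<le> real (2 ^ k) powr (1/2 - 2 * \<delta>)" for k
      using \<delta>_bounds(3) by (intro powr_mono) auto
    with elim have "\<forall>\<^sub>F k in sequentially. real (2 ^ k) powr (1/2 - \<epsilon>)
        \<le> real (2 ^ k) * discrepancy (\<lambda>n. frac (real_of_int (q n) * \<alpha>)) (2 ^ k)"
      by (auto elim!: eventually_mono intro: order_trans)
    then show ?case
      by (rule frequently_sequentially_subseq[of "\<lambda>k. 2 ^ k", rotated]) (simp add: strict_mono_def)
  qed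
qed

section \<open>The divisor bound\<close>

lemma card_divisors_mult_le:
  fixes a b :: nat
  assumes "a > 0" "b > 0"
  shows "card {d. d dvd a * b} \<le> card {d. d dvd a} * card {d. d dvd b}"
proof -
  have fin: "finite {d. d dvd a}" "finite {d. d dvd b}"
    using assms by auto
  have "{d. d dvd a * b} \<subseteq> (\<lambda>(x, y). x * y) ` ({d. d dvd a} \<times> {d. d dvd b})"
    by (auto dest!: division_decomp)
  then have "card {d. d dvd a * b} \<le> card ({d. d dvd a} \<times> {d. d dvd b})"
    using fin by (intro surj_card_le) auto
  then show ?thesis
    by (simp add: card_cartesian_product)
qed

lemma card_divisors_prod_le:
  fixes f :: "'i \<Rightarrow> nat"
  assumes "finite A" "\<And>i. i \<in> A \<Longrightarrow> f i > 0"
  shows "card {d. d dvd prod f A} \<le> (\<Prod>i\<in>A. card {d. d dvd f i})"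
  using assms
proof (induction A)
  case (insert i A)
  then have "card {d. d dvd f i * prod f A} \<le> card {d. d dvd f i} * card {d. d dvd prod f A}"
    by (intro card_divisors_mult_le) (auto intro: prod_pos)
  also have "\<dots> \<le> card {d. d dvd f i} * (\<Prod>i\<in>A. card {d. d dvd f i})"
    using insert by (intro mult_left_mono) auto
  finally show ?case
    using insert.hyps by simp
qed simp

lemma card_divisors_le_prod_Suc_multiplicity:
  fixes n :: nat
  assumes "n > 0"
  shows "card {d. d dvd n} \<le> (\<Prod>p\<in>prime_factors n. Suc (multiplicity p n))"
proof -
  have "card {d. d dvd n} \<le> (\<Prod>p\<in>prime_factors n. card {d. d dvd p ^ multiplicity p n})"
    using card_divisors_prod_le[of "prime_factors n" "\<lambda>p. p ^ multiplicity p n"] assms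
    by (simp add: prime_factorization_nat[symmetric] in_prime_factors_imp_prime prime_gt_0_nat)
  also have "\<dots> \<le> (\<Prod>p\<in>prime_factors n. Suc (multiplicity p n))"
  proof (intro prod_mono conjI)
    fix p assume "p \<in> prime_factors n"
    then have "{d. d dvd p ^ multiplicity p n} = (\<lambda>i. p ^ i) ` {..multiplicity p n}"
      using divides_primepow_nat[of p] by (auto simp: in_prime_factors_imp_prime)
    then show "card {d. d dvd p ^ multiplicity p n} \<le> Suc (multiplicity p n)"
      using card_image_le[of "{..multiplicity p n}" "\<lambda>i. p ^ i"] by simp
  qed simp
  finally show ?thesis .
qed

lemma Suc_le_const_mult_powr:
  fixes \<eta> p :: real
  assumes "\<eta> > 0" "p \<ge> 2"
  shows "real (Suc a) \<le> max 1 (1 / (\<eta> * ln 2)) * (p ^ a) powr \<eta>"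
proof -
  define K where "K = max 1 (1 / (\<eta> * ln 2))"
  have K_ge: "K \<ge> 1" "1 \<le> K * (\<eta> * ln 2)"
    using assms(1) by (auto simp: K_def max_def field_simps)
  have "real (Suc a) \<le> K + real a * (K * (\<eta> * ln 2))"
    using K_ge mult_left_mono[OF K_ge(2), of "real a"] by simp
  also have "\<dots> = K * (1 + real a * (\<eta> * ln 2))"
    by (simp add: algebra_simps)
  also have "\<dots> \<le> K * exp (real a * (\<eta> * ln 2))"
    using K_ge(1) by (intro mult_left_mono exp_ge_add_one_self) auto
  also have "exp (real a * (\<eta> * ln 2)) = (2 ^ a) powr \<eta>"
    by (simp add: powr_def ln_realpow mult_ac)
  also have "K * (2 ^ a) powr \<eta> \<le> K * (p ^ a) powr \<eta>"
    using K_ge(1) assms by (intro mult_left_mono powr_mono2 power_mono) auto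
  finally show ?thesis by (simp add: K_def)
qed

lemma Suc_le_powr:
  fixes \<eta> p :: real
  assumes "\<eta> > 0" "p > 0" "2 powr (1 / \<eta>) \<le> p"
  shows "real (Suc a) \<le> (p ^ a) powr \<eta>"
proof -
  have "(2 powr (1 / \<eta>)) powr \<eta> \<le> p powr \<eta>"
    using assms by (intro powr_mono2) auto
  then have "2 \<le> p powr \<eta>"
    using assms by (simp add: powr_powr)
  have "real (Suc a) \<le> 2 ^ a"
    using of_nat_mono[OF Suc_leI[OF less_exp[of a]], where ?'a = real] by simp
  also have "\<dots> \<le> (p powr \<eta>) ^ a"
    using \<open>2 \<le> p powr \<eta>\<close> by (intro power_mono) auto
  also have "\<dots> = (p ^ a) powr \<eta>"
    using assms by (simp add: powr_powr mult.commute flip: powr_realpow)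
  finally show ?thesis .
qed

text \<open>Only primes below \<open>2 powr (1/\<eta>)\<close> contribute a factor larger than one to
  the quotient of the divisor function by \<open>n powr \<eta>\<close>.\<close>

lemma card_divisors_le_powr:
  fixes \<eta> :: real
  assumes "\<eta> > 0"
  obtains C where "C > 0" "\<And>n::nat. n > 0 \<Longrightarrow> real (card {d. d dvd n}) \<le> C * real n powr \<eta>"
proof
  define K where "K = max 1 (1 / (\<eta> * ln 2))"
  define Q where "Q = nat \<lceil>2 powr (1 / \<eta>)\<rceil>"
  define c where "c p = (if p < Q then K else 1)" for p
  have "K \<ge> 1" by (simp add: K_def)
  then show "K ^ Q > 0" by simp
  have Suc_le: "real (Suc a) \<le> c p * (real p ^ a) powr \<eta>" if "p \<ge> 2" for p a
  proof (cases "p < Q")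
    case True
    then show ?thesis
      using Suc_le_const_mult_powr[OF assms, of "real p" a] that by (simp add: c_def K_def)
  next
    case False
    then have "2 powr (1 / \<eta>) \<le> real p"
      unfolding Q_def by linarith
    then show ?thesis
      using Suc_le_powr[OF assms, of "real p" a] that False by (simp add: c_def)
  qed
  fix n :: nat assume "n > 0"
  let ?v = "\<lambda>p. multiplicity p n"
  have "real (card {d. d dvd n}) \<le> (\<Prod>p\<in>prime_factors n. real (Suc (?v p)))"
    using of_nat_mono[OF card_divisors_le_prod_Suc_multiplicity[OF \<open>n > 0\<close>], where ?'a = real] by simp
  also have "\<dots> \<le> (\<Prod>p\<in>prime_factors n. c p * (real p ^ ?v p) powr \<eta>)"
    by (intro prod_mono conjI Suc_le) (auto intro: prime_ge_2_nat)
  also have "\<dots> = prod c (prime_factors n) * (\<Prod>p\<in>prime_factors n. real p ^ ?v p) powr \<eta>"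
    by (simp add: prod.distrib prod_powr_distrib)
  also have "(\<Prod>p\<in>prime_factors n. real p ^ ?v p) = real n"
    using \<open>n > 0\<close> by (simp add: prod_prime_factors flip: of_nat_power of_nat_prod)
  also have "prod c (prime_factors n) * real n powr \<eta> \<le> K ^ Q * real n powr \<eta>"
  proof (rule mult_right_mono)
    have "card (prime_factors n \<inter> {p. p < Q}) \<le> card {..<Q}"
      by (intro card_mono) auto
    then show "prod c (prime_factors n) \<le> K ^ Q"
      using \<open>K \<ge> 1\<close> by (simp add: c_def prod.If_cases power_increasing)
  qed simp
  finally show "real (card {d. d dvd n}) \<le> K ^ Q * real n powr \<eta>" .
qed

lemma card_int_divisors_le:
  fixes W :: int
  assumes "W \<noteq> 0"
  shows "card {x. x dvd W} \<le> 2 * card {d. d dvd nat \<bar>W\<bar>}"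
proof -
  let ?D = "{d. d dvd nat \<bar>W\<bar>}"
  have "finite ?D"
    using assms by (intro finite_divisors_nat) simp
  have "{x. x dvd W} \<subseteq> int ` ?D \<union> (\<lambda>d. - int d) ` ?D"
  proof
    fix x assume "x \<in> {x. x dvd W}"
    then have "nat \<bar>x\<bar> \<in> ?D"
      by (simp add: nat_dvd_iff)
    moreover have "x = int (nat \<bar>x\<bar>) \<or> x = - int (nat \<bar>x\<bar>)" by linarith
    ultimately show "x \<in> int ` ?D \<union> (\<lambda>d. - int d) ` ?D" by blast
  qed
  then have "card {x. x dvd W} \<le> card (int ` ?D \<union> (\<lambda>d. - int d) ` ?D)"
    using \<open>finite ?D\<close> by (intro card_mono) auto
  also have "\<dots> \<le> card (int ` ?D) + card ((\<lambda>d. - int d) ` ?D)"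
    by (rule card_Un_le)
  also have "\<dots> \<le> card ?D + card ?D"
    using \<open>finite ?D\<close> by (intro add_mono card_image_le)
  finally show ?thesis by simp
qed

lemma card_int_divisors_le_powr:
  fixes \<eta> :: real
  assumes "\<eta> > 0"
  obtains C where "C > 0"
    "\<And>W::int. W \<noteq> 0 \<Longrightarrow> real (card {x. x dvd W}) \<le> C * real_of_int \<bar>W\<bar> powr \<eta>"
proof -
  obtain C where "C > 0"
    and divisors_le: "\<And>n::nat. n > 0 \<Longrightarrow> real (card {d. d dvd n}) \<le> C * real n powr \<eta>"
    using card_divisors_le_powr[OF assms] by metis
  show ?thesis
  proof
    show "2 * C > 0" using \<open>C > 0\<close> by simp
    fix W :: int assume "W \<noteq> 0"
    then have "real (card {x. x dvd W}) \<le> 2 * real (card {d. d dvd nat \<bar>W\<bar>})"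
      using card_int_divisors_le by force
    also have "\<dots> \<le> 2 * (C * real (nat \<bar>W\<bar>) powr \<eta>)"
      using divisors_le[of "nat \<bar>W\<bar>"] \<open>W \<noteq> 0\<close> by simp
    finally show "real (card {x. x dvd W}) \<le> 2 * C * real_of_int \<bar>W\<bar> powr \<eta>"
      by simp
  qed
qed

section \<open>Polynomial sequences\<close>

lemma dvd_poly_diff:
  fixes p :: "'a::comm_ring_1 poly"
  shows "x - y dvd poly p x - poly p y"
proof (induction p)
  case (pCons c p)
  have "poly (pCons c p) x - poly (pCons c p) y = x * (poly p x - poly p y) + (x - y) * poly p y"
    by (simp add: algebra_simps)
  then show ?case
    using pCons.IH by (metis dvd_add dvd_mult dvd_triv_left)
qed simp

lemma poly_const_increment_imp_degree_le_1:
  fixes p :: "'a::{idom,ring_char_0} poly"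
  assumes "e \<noteq> 0" and increment: "\<And>y. poly p (y + e) = poly p y + v"
  shows "degree p \<le> 1"
proof -
  \<comment> \<open>\<open>p\<close> is affine along the multiples of \<open>e\<close>.\<close>
  have linear: "poly p (of_nat k * e) = poly p 0 + of_nat k * v" for k
  proof (induction k)
    case (Suc k)
    then show ?case
      using increment[of "of_nat k * e"] by (simp add: algebra_simps)
  qed simp
  define r where "r = pcompose p [:0, e:] - [:poly p 0, v:]"
  have "range of_nat \<subseteq> {x. poly r x = 0}"
    using linear by (auto simp: r_def poly_pcompose mult.commute)
  moreover have "infinite (range (of_nat :: nat \<Rightarrow> 'a))"
    by (simp add: finite_image_iff inj_of_nat)
  ultimately have "r = 0"
    using poly_roots_finite[of r] finite_subset by blast
  then have "degree (pcompose p [:0, e:]) \<le> 1"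
    by (simp add: r_def)
  then show ?thesis
    using \<open>e \<noteq> 0\<close> by (simp add: degree_pcompose)
qed

lemma
  fixes p :: "'a::{idom,ring_char_0} poly"
  assumes "degree p \<ge> 2" "e \<noteq> 0"
  shows finite_poly_increment_eq: "finite {y. poly p (y + e) - poly p y = v}"
    and card_poly_increment_eq_le: "card {y. poly p (y + e) - poly p y = v} \<le> degree p"
proof -
  define q where "q = pcompose p [:e, 1:] - p - [:v:]"
  have poly_q: "poly q y = poly p (y + e) - poly p y - v" for y
    by (simp add: q_def poly_pcompose add.commute)
  then have roots: "{y. poly p (y + e) - poly p y = v} = {y. poly q y = 0}"
    by auto
  have "q \<noteq> 0"
  proof
    assume "q = 0"
    then have "poly p (y + e) = poly p y + v" for y
      using poly_q[of y] by (simp add: algebra_simps)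
    then show False
      using poly_const_increment_imp_degree_le_1[of e p v] assms by simp
  qed
  then show "finite {y. poly p (y + e) - poly p y = v}"
    unfolding roots by (rule poly_roots_finite)
  have "card {y. poly q y = 0} \<le> degree q"
    using \<open>q \<noteq> 0\<close> by (rule card_poly_roots_bound)
  also have "degree q \<le> degree p"
    unfolding q_def by (intro degree_diff_le) (auto simp: degree_pcompose)
  finally show "card {y. poly p (y + e) - poly p y = v} \<le> degree p"
    unfolding roots .
qed

lemma dilated_poly_diff_solutions_subset:
  fixes p :: "int poly" and W :: int
  assumes "W \<noteq> 0"
  shows "{(h, x, y). h * (poly p x - poly p y) = W} \<subseteq> (\<lambda>((h, e), y). (h, y + e, y)) `
    (SIGMA (h, e):{d. d dvd W} \<times> ({d. d dvd W} - {0}). {y. poly p (y + e) - poly p y = W div h})"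
    (is "_ \<subseteq> _ ` ?T")
proof
  fix z assume "z \<in> {(h, x, y). h * (poly p x - poly p y) = W}"
  then obtain h x y where z_eq: "z = (h, x, y)" and W_eq: "W = h * (poly p x - poly p y)"
    by auto
  have "((h, x - y), y) \<in> ?T"
    using dvd_poly_diff[of x y p] assms by (auto simp: W_eq)
  then show "z \<in> (\<lambda>((h, e), y). (h, y + e, y)) ` ?T"
    by (rule rev_image_eqI) (simp add: z_eq)
qed

lemma
  fixes p :: "int poly" and W :: int
  assumes "degree p \<ge> 2" "W \<noteq> 0"
  shows finite_dilated_poly_diff_solutions: "finite {(h, x, y). h * (poly p x - poly p y) = W}"
    and card_dilated_poly_diff_solutions_le:
      "card {(h, x, y). h * (poly p x - poly p y) = W} \<le> degree p * (card {d. d dvd W})\<^sup>2"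
proof -
  define D where "D = {d. d dvd W}"
  define R where "R = (\<lambda>(h, e). {y. poly p (y + e) - poly p y = W div h})"
  have "finite D"
    using \<open>W \<noteq> 0\<close> by (simp add: D_def)
  have fibre: "finite (R z)" "card (R z) \<le> degree p" if "z \<in> D \<times> (D - {0})" for z
    using that finite_poly_increment_eq[OF assms(1)] card_poly_increment_eq_le[OF assms(1)]
    by (auto simp: R_def)
  note subset = dilated_poly_diff_solutions_subset[OF \<open>W \<noteq> 0\<close>, of p, folded D_def R_def]
  have finite_Sigma: "finite (Sigma (D \<times> (D - {0})) R)"
    using fibre(1) \<open>finite D\<close> by (intro finite_SigmaI) auto
  from finite_subset[OF subset finite_imageI[OF finite_Sigma]]
  show "finite {(h, x, y). h * (poly p x - poly p y) = W}" .
  have "card {(h, x, y). h * (poly p x - poly p y) = W} \<le> card (Sigma (D \<times> (D - {0})) R)"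
    using finite_Sigma subset by (rule surj_card_le)
  also have "\<dots> = (\<Sum>z\<in>D \<times> (D - {0}). card (R z))"
    using fibre(1) \<open>finite D\<close> by (intro card_SigmaI) auto
  also have "\<dots> \<le> card (D \<times> (D - {0})) * degree p"
    using sum_mono[OF fibre(2), of "D \<times> (D - {0})"] by simp
  also have "\<dots> \<le> card (D \<times> D) * degree p"
    using \<open>finite D\<close> by (intro mult_right_mono card_mono) auto
  also have "\<dots> = degree p * (card D)\<^sup>2"
    by (simp add: card_cartesian_product power2_eq_square)
  finally show "card {(h, x, y). h * (poly p x - poly p y) = W} \<le> degree p * (card {d. d dvd W})\<^sup>2"
    by (simp add: D_def)
qed

lemma abs_poly_le:
  fixes p :: "'a::linordered_idom poly"
  shows "\<bar>poly p x\<bar> \<le> (\<Sum>i\<le>degree p. \<bar>coeff p i\<bar>) * max 1 \<bar>x\<bar> ^ degree p"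
proof -
  have "\<bar>poly p x\<bar> \<le> (\<Sum>i\<le>degree p. \<bar>coeff p i * x ^ i\<bar>)"
    unfolding poly_altdef by (rule sum_abs)
  also have "\<dots> \<le> (\<Sum>i\<le>degree p. \<bar>coeff p i\<bar> * max 1 \<bar>x\<bar> ^ degree p)"
  proof (rule sum_mono)
    fix i assume "i \<in> {..degree p}"
    then have "\<bar>x\<bar> ^ i \<le> max 1 \<bar>x\<bar> ^ degree p"
      by (intro order_trans[OF power_mono power_increasing]) auto
    then show "\<bar>coeff p i * x ^ i\<bar> \<le> \<bar>coeff p i\<bar> * max 1 \<bar>x\<bar> ^ degree p"
      by (simp add: abs_mult power_abs mult_left_mono)
  qed
  finally show ?thesis by (simp add: sum_distrib_right)
qed

lemma polynomial_growth_uniform: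
  fixes f :: "nat \<Rightarrow> real"
  assumes "\<And>n. n \<ge> n0 \<Longrightarrow> \<bar>f n\<bar> \<le> real n ^ t"
  obtains C where "1 \<le> C" "\<And>n N. 1 \<le> N \<Longrightarrow> n \<le> N \<Longrightarrow> \<bar>f n\<bar> \<le> C * real N ^ t"
proof
  let ?C = "1 + (\<Sum>n<n0. \<bar>f n\<bar>)"
  show "1 \<le> ?C" by (simp add: sum_nonneg)
  fix n N :: nat assume "1 \<le> N" "n \<le> N"
  then have "1 \<le> real N ^ t" by (simp add: one_le_power)
  show "\<bar>f n\<bar> \<le> ?C * real N ^ t"
  proof (cases "n < n0")
    case True
    then have "\<bar>f n\<bar> \<le> (\<Sum>n<n0. \<bar>f n\<bar>)"
      by (intro member_le_sum) auto
    then have "\<bar>f n\<bar> \<le> ?C * 1" by simp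
    also have "\<dots> \<le> ?C * real N ^ t"
      using \<open>1 \<le> real N ^ t\<close> \<open>1 \<le> ?C\<close> by (intro mult_left_mono) auto
    finally show ?thesis .
  next
    case False
    then have "\<bar>f n\<bar> \<le> real n ^ t"
      using assms by simp
    also have "\<dots> \<le> 1 * real N ^ t"
      using \<open>n \<le> N\<close> by (simp add: power_mono)
    also have "\<dots> \<le> ?C * real N ^ t"
      using \<open>1 \<le> ?C\<close> by (intro mult_right_mono) auto
    finally show ?thesis .
  qed
qed

lemma poly_values_growth:
  fixes P :: "int poly" and m :: "nat \<Rightarrow> int"
  assumes "\<exists>n0. \<forall>n\<ge>n0. real_of_int \<bar>m n\<bar> \<le> real n ^ t"
  obtains C s where "0 < C"
    "\<And>n N. 1 \<le> N \<Longrightarrow> n \<le> N \<Longrightarrow> real_of_int \<bar>poly P (m n)\<bar> \<le> C * real N ^ s"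
proof -
  obtain B where "1 \<le> B"
    and m_le: "\<And>n N. 1 \<le> N \<Longrightarrow> n \<le> N \<Longrightarrow> \<bar>real_of_int (m n)\<bar> \<le> B * real N ^ t"
    using assms polynomial_growth_uniform[of _ "\<lambda>n. real_of_int (m n)" t] by (metis of_int_abs)
  define K where "K = 1 + real_of_int (\<Sum>i\<le>degree P. \<bar>coeff P i\<bar>)"
  have "1 \<le> K" by (simp add: K_def sum_nonneg)
  show ?thesis
  proof
    show "0 < K * B ^ degree P"
      using \<open>1 \<le> K\<close> \<open>1 \<le> B\<close> by simp
    fix n N :: nat assume "1 \<le> N" "n \<le> N"
    have "1 \<le> B * real N ^ t"
      using \<open>1 \<le> B\<close> \<open>1 \<le> N\<close> mult_mono[of 1 B 1 "real N ^ t"] by (simp add: one_le_power)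
    have "real_of_int \<bar>poly P (m n)\<bar>
        \<le> real_of_int ((\<Sum>i\<le>degree P. \<bar>coeff P i\<bar>) * max 1 \<bar>m n\<bar> ^ degree P)"
      unfolding of_int_le_iff by (rule abs_poly_le)
    also have "\<dots> = (K - 1) * max 1 \<bar>real_of_int (m n)\<bar> ^ degree P"
      by (simp add: K_def of_int_max)
    also have "\<dots> \<le> K * (B * real N ^ t) ^ degree P"
      using m_le[OF \<open>1 \<le> N\<close> \<open>n \<le> N\<close>] \<open>1 \<le> B * real N ^ t\<close> \<open>1 \<le> K\<close>
      by (intro mult_mono power_mono) auto
    finally show "real_of_int \<bar>poly P (m n)\<bar> \<le> K * B ^ degree P * real N ^ (t * degree P)"
      by (simp add: power_mult_distrib power_mult mult.assoc)
  qed
qed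

lemma abs_dilated_diff_le:
  assumes "i \<in> {1..H} \<times> {1..N} \<times> {1..N}" "\<And>n. n \<in> {1..N} \<Longrightarrow> real_of_int \<bar>q n\<bar> \<le> B"
  shows "real_of_int \<bar>dilated_diff q i\<bar> \<le> real H * (2 * B)"
proof -
  obtain h a b where triple: "i = (h, a, b)" "h \<le> H" "a \<in> {1..N}" "b \<in> {1..N}"
    using assms(1) by auto
  then have "real_of_int \<bar>q a - q b\<bar> \<le> 2 * B"
    using assms(2)[of a] assms(2)[of b] by simp
  then have "real h * real_of_int \<bar>q a - q b\<bar> \<le> real H * (2 * B)"
    using triple by (intro mult_mono) auto
  then show ?thesis
    by (simp add: triple dilated_diff_def abs_mult)
qed

lemma card_divisors_dilated_diff_le_powr:
  fixes K \<delta> :: real and q :: "nat \<Rightarrow> int"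
  assumes "0 < \<delta>" "0 < K"
    and growth: "\<And>n N. 1 \<le> N \<Longrightarrow> n \<le> N \<Longrightarrow> real_of_int \<bar>q n\<bar> \<le> K * real N ^ s"
  obtains C where "\<And>H N i. 1 \<le> N \<Longrightarrow> H \<le> N \<Longrightarrow> i \<in> nonzero_triples q H N \<Longrightarrow>
    real (card {d. d dvd dilated_diff q i}) \<le> C * real N powr \<delta>"
proof -
  define \<eta> where "\<eta> = \<delta> / real (Suc s)"
  have "0 < \<eta>" using \<open>0 < \<delta>\<close> by (simp add: \<eta>_def)
  obtain C where "0 < C"
    and divisors_le: "\<And>W::int. W \<noteq> 0 \<Longrightarrow> real (card {d. d dvd W}) \<le> C * real_of_int \<bar>W\<bar> powr \<eta>"
    by (rule card_int_divisors_le_powr[OF \<open>0 < \<eta>\<close>]) (rule that)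
  show ?thesis
  proof
    fix H N i assume "1 \<le> N" "H \<le> N" "i \<in> nonzero_triples q H N"
    then have triple: "i \<in> {1..H} \<times> {1..N} \<times> {1..N}" "dilated_diff q i \<noteq> 0"
      by (auto simp: nonzero_triples_def)
    have "real_of_int \<bar>dilated_diff q i\<bar> \<le> real H * (2 * (K * real N ^ s))"
      using triple(1) by (rule abs_dilated_diff_le) (use growth \<open>1 \<le> N\<close> in auto)
    also have "\<dots> \<le> real N * (2 * (K * real N ^ s))"
      using \<open>H \<le> N\<close> \<open>0 < K\<close> by (intro mult_right_mono) auto
    finally have size: "real_of_int \<bar>dilated_diff q i\<bar> \<le> 2 * K * real N ^ Suc s"
      by (simp add: mult_ac)
    have "real (card {d. d dvd dilated_diff q i}) \<le> C * real_of_int \<bar>dilated_diff q i\<bar> powr \<eta>"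
      using triple(2) by (rule divisors_le)
    also have "\<dots> \<le> C * (2 * K * real N ^ Suc s) powr \<eta>"
      using \<open>0 < C\<close> \<open>0 < \<eta>\<close> size by (intro mult_left_mono powr_mono2) auto
    also have "\<dots> = C * (2 * K) powr \<eta> * real N powr (real (Suc s) * \<eta>)"
      using \<open>1 \<le> N\<close> by (simp add: powr_mult powr_powr del: power_Suc of_nat_Suc flip: powr_realpow)
    also have "real (Suc s) * \<eta> = \<delta>"
      by (simp add: \<eta>_def del: of_nat_Suc)
    finally show "real (card {d. d dvd dilated_diff q i}) \<le> C * (2 * K) powr \<eta> * real N powr \<delta>" .
  qed
qed

lemma card_dilated_diff_poly_fibre_le:
  fixes P :: "int poly" and m :: "nat \<Rightarrow> int"
  assumes "degree P \<ge> 2" "inj_on m {1..}" "W \<noteq> 0"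
  defines "q \<equiv> \<lambda>n. poly P (m n)"
  shows "card {i \<in> nonzero_triples q H N. dilated_diff q i = W} \<le> degree P * (card {d. d dvd W})\<^sup>2"
proof -
  let ?F = "{i \<in> nonzero_triples q H N. dilated_diff q i = W}"
  let ?f = "\<lambda>(h, a, b). (int h, m a, m b)"
  have "inj_on ?f ?F"
    using assms(2) by (auto simp: nonzero_triples_def inj_on_def)
  moreover have "?f ` ?F \<subseteq> {(h, x, y). h * (poly P x - poly P y) = W}"
    by (auto simp: dilated_diff_def q_def)
  ultimately have "card ?F \<le> card {(h, x, y). h * (poly P x - poly P y) = W}"
    using finite_dilated_poly_diff_solutions[OF assms(1,3)] by (rule card_inj_on_le)
  also have "\<dots> \<le> degree P * (card {d. d dvd W})\<^sup>2"
    using assms(1,3) by (rule card_dilated_poly_diff_solutions_le)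
  finally show ?thesis .
qed

theorem few_dilate_collisions_poly:
  fixes P :: "int poly" and m :: "nat \<Rightarrow> int"
  assumes P: "degree P \<ge> 2" and m: "inj_on m {1..}"
    and growth: "\<exists>n0. \<forall>n\<ge>n0. real_of_int \<bar>m n\<bar> \<le> real n ^ t"
  shows "few_dilate_collisions (\<lambda>n. poly P (m n))"
  unfolding few_dilate_collisions_def
proof (intro allI impI)
  fix \<delta> :: real assume "0 < \<delta>"
  define q where "q = (\<lambda>n. poly P (m n))"
  obtain K s where "0 < K"
    and q_le: "\<And>n N. 1 \<le> N \<Longrightarrow> n \<le> N \<Longrightarrow> real_of_int \<bar>q n\<bar> \<le> K * real N ^ s"
    using poly_values_growth[OF growth, of P] unfolding q_def by metis
  obtain C where divisors_le: "\<And>H N i. 1 \<le> N \<Longrightarrow> H \<le> N \<Longrightarrow> i \<in> nonzero_triples q H N \<Longrightarrow>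
      real (card {d. d dvd dilated_diff q i}) \<le> C * real N powr (\<delta> / 2)"
    by (rule card_divisors_dilated_diff_le_powr[where q = q, OF half_gt_zero[OF \<open>0 < \<delta>\<close>] \<open>0 < K\<close>])
      (erule (1) q_le, rule that)
  define M where "M = real (degree P) * C\<^sup>2"
  have "real (card (dilate_collisions q H N)) \<le> M * real N powr \<delta> * real (H * N\<^sup>2)"
    if "1 \<le> N" "H \<le> N" for H N
  proof (rule card_dilate_collisions_le)
    show "0 \<le> M * real N powr \<delta>" by (simp add: M_def)
    fix i assume i: "i \<in> nonzero_triples q H N"
    then have "dilated_diff q i \<noteq> 0"
      by (simp add: nonzero_triples_def)
    then have "real (card {i' \<in> nonzero_triples q H N. dilated_diff q i' = dilated_diff q i})
        \<le> real (degree P * (card {d. d dvd dilated_diff q i})\<^sup>2)"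
      unfolding q_def using P m by (intro of_nat_mono card_dilated_diff_poly_fibre_le)
    also have "\<dots> \<le> real (degree P) * (C * real N powr (\<delta> / 2))\<^sup>2"
      using divisors_le[OF that i] by (simp add: mult_left_mono power_mono)
    also have "\<dots> = M * real N powr \<delta>"
      by (simp add: M_def power_mult_distrib power2_eq_square[of "_ powr (\<delta> / 2)"] flip: powr_add)
    finally show "real (card {i' \<in> nonzero_triples q H N. dilated_diff q i' = dilated_diff q i})
        \<le> M * real N powr \<delta>" .
  qed
  then show "\<exists>M. \<forall>N\<ge>1. \<forall>H\<le>N. real (card (dilate_collisions (\<lambda>n. poly P (m n)) H N))
      \<le> M * real N powr \<delta> * real (H * N\<^sup>2)"
    unfolding q_def by blast
qed

theorem theorem1:
  fixes P :: "int poly" and m :: "nat \<Rightarrow> int" and t :: nat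
  assumes "degree P \<ge> 2"
    and "inj_on m {1..}"
    and "\<exists>n0. \<forall>n\<ge>n0. real_of_int \<bar>m n\<bar> \<le> real n ^ t"
  shows "AE \<alpha> in lborel. \<forall>\<epsilon>>0. \<exists>\<^sub>\<infinity>N.
     real N * discrepancy (\<lambda>n. frac (real_of_int (poly P (m n)) * \<alpha>)) N
       \<ge> real N powr (1/2 - \<epsilon>)"
  using few_dilate_collisions_poly[OF assms] by (rule AE_infinitely_often_discrepancy_ge_powr)

end
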